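(* Let $\lambda\in(0,\infty)$. If natural numbers $m_1,m_2\ge1$ are such that $m_1\le\lambda\le m_2$, then $\mathsf P(m_1\le X_{n,\lambda/n}\le m_2)$ is (strictly) decreasing in natural $n\ge m_2+1$ and converges, as $n\to\infty$, to $\mathsf P(m_1\le\Pi_\lambda\le m_2)$. In particular, $$\mathsf P(m_1\le X_{n,\lambda/n}\le m_2)>\mathsf P(m_1\le\Pi_\lambda\le m_2)$$ for all such $\lambda,m_1,m_2$ and all natural $n\ge m_2+1$.
   Context: $X_{n,p}$ denotes a random variable having the binomial distribution with parameters $n$ and $p$. For real $\lambda>0$, $\Pi_\lambda$ denotes a random variable having the Poisson distribution with parameter $\lambda$. *)

theory Defs
  imports "HOL-Probability.Probability"
begin

end

theory Submission
  imports Defs "HOL-Real_Asymp.Real_Asymp"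
begin

text \<open>
  Fix the mean \<open>l\<close> and give \<open>n\<close> trials the success probability \<open>a = (l - b) / n\<close> and one further
  trial the success probability \<open>b\<close>. As \<open>b\<close> grows from \<open>0\<close> to \<open>l / (n + 1)\<close>, the number of
  successes moves from the binomial law with parameters \<open>n\<close>, \<open>l / n\<close> to the one with parameters
  \<open>n + 1\<close>, \<open>l / (n + 1)\<close>. The probability of at most \<open>c\<close> successes has \<open>b\<close>-derivative
  \<open>(a - b) (P(T = c) - P(T = c - 1))\<close>, where \<open>T\<close> is binomial with parameters \<open>n - 1\<close>, \<open>a\<close>, and the
  sign of the second factor is that of \<open>n a - c = l - b - c\<close>. Hence the distribution function at
  \<open>c\<close> decreases with \<open>n\<close> if \<open>l \<le> c\<close> and increases if \<open>c + 1 \<le> l\<close>; take \<open>c = m\<^sub>2\<close> and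
  \<open>c = m\<^sub>1 - 1\<close>.
\<close>

section \<open>Binomial weights: recurrences and derivatives\<close>

lemma Bernstein_0: "Bernstein n 0 x = (1 - x) ^ n"
  by (simp add: Bernstein_def)

lemma Bernstein_eq_0: "n < k \<Longrightarrow> Bernstein n k x = 0"
  by (simp add: Bernstein_def)

text \<open>Pascal's rule, that is, conditioning on one of the trials.\<close>

lemma Bernstein_Suc_Suc:
  "Bernstein (Suc n) (Suc k) x = x * Bernstein n k x + (1 - x) * Bernstein n (Suc k) x"
proof (cases "k < n")
  case True
  then have *: "(1 - x) ^ (n - k) = (1 - x) * (1 - x) ^ (n - Suc k)"
    by (metis Suc_diff_Suc power_Suc)
  show ?thesis
    unfolding Bernstein_def diff_Suc_Suc * binomial_Suc_Suc power_Suc of_nat_add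
    by (simp add: algebra_simps)
next
  \<comment> \<open>The subtraction in \<open>n - Suc k\<close> truncates here, but
    \<open>n choose Suc k\<close> vanishes.\<close>
  case False
  then consider "k = n" | "n < k" by linarith
  then show ?thesis
    by cases (simp_all add: Bernstein_def binomial_eq_0)
qed

text \<open>The ratio of consecutive weights, from the absorption identity for binomial
  coefficients; cross-multiplied so that it also covers \<open>x = 1\<close>.\<close>

lemma Bernstein_Suc_ratio:
  assumes "k \<le> n"
  shows "(1 - x) * ((real k + 1) * Bernstein n (Suc k) x) = (real n - real k) * x * Bernstein n k x"
proof (cases "k = n")
  case True
  then show ?thesis by (simp add: Bernstein_eq_0)
next
  case False
  with assms have "k < n" by simp
  then have *: "(1 - x) ^ (n - k) = (1 - x) * (1 - x) ^ (n - Suc k)"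
    by (metis Suc_diff_Suc power_Suc)
  have "Suc k * (n choose Suc k) = (n - k) * (n choose k)"
    using binomial_absorb_comp[of n k] Suc_times_binomial_eq[of "n - 1" k] \<open>k < n\<close>
    by (metis binomial_absorption Suc_pred' less_imp_Suc_add zero_less_Suc)
  then have "real (Suc k * (n choose Suc k)) = real ((n - k) * (n choose k))"
    by presburger
  then have "(real k + 1) * real (n choose Suc k) = (real n - real k) * real (n choose k)"
    using assms by (simp add: of_nat_diff algebra_simps)
  then have "((real k + 1) * real (n choose Suc k)) * (x * x ^ k * ((1 - x) * (1 - x) ^ (n - Suc k)))
     = ((real n - real k) * real (n choose k)) * (x * x ^ k * ((1 - x) * (1 - x) ^ (n - Suc k)))"
    by simp
  then show ?thesis
    unfolding Bernstein_def * by (simp add: mult_ac)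
qed

text \<open>The weight at \<open>k - 1\<close>, with value 0 at \<open>k = 0\<close>, where
  truncated subtraction would give the weight at 0.\<close>

definition Bernstein_pred :: "nat \<Rightarrow> nat \<Rightarrow> real \<Rightarrow> real" where
  "Bernstein_pred n k x = (case k of 0 \<Rightarrow> 0 | Suc j \<Rightarrow> Bernstein n j x)"

lemma Bernstein_Suc:
  "Bernstein (Suc n) k x = x * Bernstein_pred n k x + (1 - x) * Bernstein n k x"
  by (cases k) (simp_all add: Bernstein_pred_def Bernstein_Suc_Suc Bernstein_0)

text \<open>Differentiate \<open>Bernstein_Suc\<close>: for positive \<open>k\<close> the induction
  hypothesis yields \<open>n + 1\<close> copies of the difference of weights, and the factors
  \<open>x\<close> and \<open>1 - x\<close> yield one more.\<close>

lemma DERIV_Bernstein: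
  "((Bernstein (Suc n) k) has_real_derivative
     (real n + 1) * (Bernstein_pred n k x - Bernstein n k x)) (at x)"
proof (induction n arbitrary: k)
  case 0
  consider "k = 0" | "k = 1" | "k > 1" by linarith
  then show ?case
  proof cases
    case 1
    then show ?thesis
      by (auto simp: Bernstein_def[abs_def] Bernstein_pred_def intro!: derivative_eq_intros)
  next
    case 2
    then show ?thesis
      by (auto simp: Bernstein_def[abs_def] Bernstein_pred_def intro!: derivative_eq_intros)
  next
    case 3
    then obtain j where "k = Suc (Suc j)"
      by (metis One_nat_def Suc_diff_Suc diff_Suc_1 less_natE add_Suc)
    then show ?thesis
      by (simp add: Bernstein_def[abs_def] Bernstein_pred_def)
  qed
next
  case (Suc n)
  have eq: "Bernstein (Suc (Suc n)) k
      = (\<lambda>x. x * Bernstein_pred (Suc n) k x + (1 - x) * Bernstein (Suc n) k x)"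
    by (rule ext) (rule Bernstein_Suc)
  show ?case
  proof (cases k)
    case 0
    show ?thesis
      unfolding 0 Bernstein_0[abs_def] Bernstein_pred_def
      by (rule derivative_eq_intros refl)+ simp
  next
    case k: (Suc j)
    show ?thesis
      unfolding eq unfolding k Bernstein_pred_def
      apply (rule derivative_eq_intros refl Suc.IH | simp)+
      apply (simp add: Bernstein_Suc[of n] Bernstein_pred_def algebra_simps split: nat.splits)
      done
  qed
qed

text \<open>The derivatives of the summands telescope.\<close>

lemma DERIV_sum_Bernstein:
  "((\<lambda>x. \<Sum>k\<le>c. Bernstein (Suc n) k x) has_real_derivative
     - (real n + 1) * Bernstein n c x) (at x)"
proof (induction c)
  case 0
  show ?case
    using DERIV_Bernstein[of n 0 x] by (simp add: Bernstein_pred_def algebra_simps)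
next
  case (Suc c)
  show ?case
    using DERIV_add[OF Suc.IH DERIV_Bernstein[of n "Suc c" x]]
    by (simp add: Bernstein_pred_def algebra_simps)
qed

text \<open>An extra trial pushes the count above \<open>c\<close> exactly when it succeeds after
  \<open>c\<close> earlier successes.\<close>

lemma sum_Bernstein_Suc:
  "(\<Sum>k\<le>c. Bernstein (Suc n) k x) = (\<Sum>k\<le>c. Bernstein n k x) - x * Bernstein n c x"
  by (induction c) (simp_all add: Bernstein_0 Bernstein_Suc_Suc algebra_simps)

section \<open>Position of the mode of the binomial law\<close>

lemma Bernstein_diff:
  assumes "k \<le> n"
  shows "(1 - x) * (real k + 1) * (Bernstein n (Suc k) x - Bernstein n k x)
    = Bernstein n k x * ((real n + 1) * x - real (Suc k))"
  using Bernstein_Suc_ratio[OF assms, of x] by (simp add: algebra_simps)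

lemma Bernstein_less_pred:
  assumes "0 < x" "x < 1" "0 < c" "c \<le> n" "(real n + 1) * x < real c"
  shows "Bernstein n c x < Bernstein_pred n c x"
proof -
  obtain k where k: "c = Suc k" using \<open>0 < c\<close> gr0_implies_Suc by blast
  have "Bernstein n k x * ((real n + 1) * x - real (Suc k)) < 0"
    using assms k by (intro mult_pos_neg Bernstein_pos) auto
  then have "(1 - x) * (real k + 1) * (Bernstein n (Suc k) x - Bernstein n k x) < 0"
    using Bernstein_diff[of k n x] assms k by simp
  then show ?thesis
    using assms by (simp add: k Bernstein_pred_def mult_less_0_iff)
qed

lemma pred_le_Bernstein:
  assumes "0 < x" "x < 1" "c \<le> n" "real c \<le> (real n + 1) * x"
  shows "Bernstein_pred n c x \<le> Bernstein n c x"
proof (cases c)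
  case 0
  then show ?thesis using assms by (simp add: Bernstein_pred_def Bernstein_nonneg)
next
  case k: (Suc k)
  have "Bernstein n k x * ((real n + 1) * x - real (Suc k)) \<ge> 0"
    using assms k by (intro mult_nonneg_nonneg Bernstein_nonneg) auto
  then have "(1 - x) * (real k + 1) * (Bernstein n (Suc k) x - Bernstein n k x) \<ge> 0"
    using Bernstein_diff[of k n x] assms k by simp
  moreover have "0 < (1 - x) * (real k + 1)" using assms by simp
  ultimately show ?thesis
    by (simp add: k Bernstein_pred_def zero_le_mult_iff)
qed

section \<open>Splitting off one trial\<close>

text \<open>
  The probability of at most \<open>c\<close> successes in \<open>n + 1\<close> trials with success probability
  \<open>(l - b) / (n + 1)\<close> and one more with success probability \<open>b\<close>.
\<close>

definition mixed_cdf :: "real \<Rightarrow> nat \<Rightarrow> nat \<Rightarrow> real \<Rightarrow> real" where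
  "mixed_cdf l n c b = (\<Sum>k\<le>c. Bernstein (Suc n) k ((l - b) / (real n + 1)))
      - b * Bernstein (Suc n) c ((l - b) / (real n + 1))"

lemma mixed_cdf_0: "mixed_cdf l n c 0 = (\<Sum>k\<le>c. Bernstein (Suc n) k (l / real (Suc n)))"
  by (simp add: mixed_cdf_def add.commute)

text \<open>At this \<open>b\<close> all \<open>n + 2\<close> trials have the same success
  probability.\<close>

lemma mixed_cdf_balanced:
  "mixed_cdf l n c (l / (real n + 2)) = (\<Sum>k\<le>c. Bernstein (Suc (Suc n)) k (l / real (Suc (Suc n))))"
proof -
  have "(l - l / (real n + 2)) / (real n + 1) = l / (real n + 2)"
    by (simp add: divide_simps) (simp add: algebra_simps)
  then show ?thesis
    by (simp add: mixed_cdf_def sum_Bernstein_Suc[of "Suc n"] add.commute)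
qed

text \<open>Here \<open>n + 1\<close> trials share the probability \<open>a\<close>, so the law of
  \<open>T\<close> has \<open>n\<close> trials.\<close>

lemma DERIV_mixed_cdf:
  fixes l b :: real and n :: nat
  defines "a \<equiv> (l - b) / (real n + 1)"
  shows "(mixed_cdf l n c has_real_derivative
     (a - b) * (Bernstein n c a - Bernstein_pred n c a)) (at b)"
proof -
  let ?a = "\<lambda>b. (l - b) / (real n + 1)"
  have a: "(?a has_real_derivative - 1 / (real n + 1)) (at b)"
    by (rule DERIV_cdivide) (auto intro!: derivative_eq_intros)
  have "(mixed_cdf l n c has_real_derivative
      - (real n + 1) * Bernstein n c a * (- 1 / (real n + 1))
      - (b * ((real n + 1) * (Bernstein_pred n c a - Bernstein n c a) * (- 1 / (real n + 1)))
        + 1 * Bernstein (Suc n) c a)) (at b)"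
    unfolding mixed_cdf_def[abs_def] a_def
    by (rule DERIV_diff DERIV_mult' DERIV_ident DERIV_chain2[OF DERIV_sum_Bernstein a]
        DERIV_chain2[OF DERIV_Bernstein a])+
  moreover have "(real n + 1) * y * (- 1 / (real n + 1)) = - y"
    "- (real n + 1) * y * (- 1 / (real n + 1)) = y" for y
    by (simp_all add: field_simps)
  then have "- (real n + 1) * Bernstein n c a * (- 1 / (real n + 1))
      - (b * ((real n + 1) * (Bernstein_pred n c a - Bernstein n c a) * (- 1 / (real n + 1)))
        + 1 * Bernstein (Suc n) c a) = (a - b) * (Bernstein n c a - Bernstein_pred n c a)"
    \<comment> \<open>Expanding \<open>Bernstein (Suc n) c a\<close> supplies the coefficient
      \<open>a\<close>; the derivative of the weight multiplied by \<open>b\<close> supplies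
      \<open>- b\<close>.\<close>
    unfolding Bernstein_Suc by (simp only:) (simp add: algebra_simps)
  ultimately show ?thesis by simp
qed

text \<open>Before the balanced point the factor \<open>a - b\<close> of the derivative is
  positive.\<close>

lemma split_trial_bounds:
  fixes l b :: real
  assumes "0 < b" "b < l / (real n + 2)" "l \<le> real n + 1"
  shows "0 < (l - b) / (real n + 1)" "(l - b) / (real n + 1) < 1" "b < (l - b) / (real n + 1)"
    "b < 1"
proof -
  have *: "b * (real n + 2) < l" using assms by (simp add: field_simps)
  have "b * (real n + 2) \<ge> b * 2" using assms by (intro mult_left_mono) auto
  then have "b < l" using * assms by linarith
  then show "0 < (l - b) / (real n + 1)" by simp
  show "(l - b) / (real n + 1) < 1" using assms by (simp add: field_simps)
  show "b < (l - b) / (real n + 1)" using * by (simp add: field_simps)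
  with \<open>(l - b) / (real n + 1) < 1\<close> show "b < 1" by linarith
qed

section \<open>Monotonicity in the number of trials\<close>

lemma binomial_cdf_decreasing:
  assumes "0 < l" "0 < c" "l \<le> real c" "c \<le> n"
  shows "(\<Sum>k\<le>c. Bernstein (Suc (Suc n)) k (l / real (Suc (Suc n))))
    < (\<Sum>k\<le>c. Bernstein (Suc n) k (l / real (Suc n)))"
proof -
  have "mixed_cdf l n c (l / (real n + 2)) < mixed_cdf l n c 0"
  proof (rule DERIV_neg_imp_decreasing_open[where f = "mixed_cdf l n c"])
    show "0 < l / (real n + 2)" using assms by simp
    show "continuous_on {0..l / (real n + 2)} (mixed_cdf l n c)"
      by (intro continuous_at_imp_continuous_on ballI DERIV_continuous[OF DERIV_mixed_cdf])
    fix b assume b: "0 < b" "b < l / (real n + 2)"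
    define a where "a = (l - b) / (real n + 1)"
    have "l \<le> real n + 1" using assms by simp
    note bounds = split_trial_bounds[OF b this, folded a_def]
    have "(real n + 1) * a = l - b" by (simp add: a_def)
    \<comment> \<open>Since \<open>b > 0\<close>, \<open>l - b < c\<close> is strict even if
      \<open>l = c\<close>.\<close>
    then have "Bernstein n c a < Bernstein_pred n c a"
      using assms b bounds by (intro Bernstein_less_pred) auto
    then have "(a - b) * (Bernstein n c a - Bernstein_pred n c a) < 0"
      using bounds by (intro mult_pos_neg) auto
    with DERIV_mixed_cdf[of l n c b, folded a_def]
    show "\<exists>y. (mixed_cdf l n c has_real_derivative y) (at b) \<and> y < 0"
      by blast
  qed
  then show ?thesis by (simp only: mixed_cdf_0 mixed_cdf_balanced)
qed

text \<open>The weak inequality suffices: strictness comes from the upper endpoint of the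
  interval.\<close>

lemma binomial_cdf_increasing:
  assumes "0 < l" "real c + 1 \<le> l" "l \<le> real n + 1"
  shows "(\<Sum>k\<le>c. Bernstein (Suc n) k (l / real (Suc n)))
    \<le> (\<Sum>k\<le>c. Bernstein (Suc (Suc n)) k (l / real (Suc (Suc n))))"
proof -
  have "mixed_cdf l n c 0 \<le> mixed_cdf l n c (l / (real n + 2))"
  proof (rule DERIV_nonneg_imp_increasing_open[where f = "mixed_cdf l n c"])
    show "0 \<le> l / (real n + 2)" using assms by simp
    show "continuous_on {0..l / (real n + 2)} (mixed_cdf l n c)"
      by (intro continuous_at_imp_continuous_on ballI DERIV_continuous[OF DERIV_mixed_cdf])
    fix b assume b: "0 < b" "b < l / (real n + 2)"
    define a where "a = (l - b) / (real n + 1)"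
    note bounds = split_trial_bounds[OF b assms(3), folded a_def]
    have "(real n + 1) * a = l - b" by (simp add: a_def)
    \<comment> \<open>From \<open>c + 1 \<le> l\<close> and \<open>b < 1\<close> follows
      \<open>c \<le> l - b\<close>.\<close>
    then have "Bernstein_pred n c a \<le> Bernstein n c a"
      using assms bounds by (intro pred_le_Bernstein) auto
    then have "0 \<le> (a - b) * (Bernstein n c a - Bernstein_pred n c a)"
      using bounds by (intro mult_nonneg_nonneg) auto
    with DERIV_mixed_cdf[of l n c b, folded a_def]
    show "\<exists>y. (mixed_cdf l n c has_real_derivative y) (at b) \<and> 0 \<le> y"
      by blast
  qed
  then show ?thesis by (simp only: mixed_cdf_0 mixed_cdf_balanced)
qed

section \<open>Poisson limit\<close>

lemma Bernstein_tendsto_poisson: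
  "(\<lambda>n. Bernstein n k (l / real n)) \<longlonglongrightarrow> l ^ k / fact k * exp (- l)"
proof (induction k)
  case 0
  show ?case
    using tendsto_exp_limit_sequentially[of "- l"] by (simp add: Bernstein_0)
next
  case (Suc k)
  have "(\<lambda>n. 1 - l / real n) \<longlonglongrightarrow> 1" by real_asymp
  then have pos: "eventually (\<lambda>n. 1 - l / real n > 0) sequentially"
    by (rule order_tendstoD) simp
  \<comment> \<open>The ratio of consecutive binomial weights tends to that of the Poisson
    weights.\<close>
  have "(\<lambda>n. (real n - real k) * (l / real n) / ((1 - l / real n) * (real k + 1)))
      \<longlonglongrightarrow> l / (real k + 1)"
    unfolding divide_inverse[of l "real k + 1"] by real_asymp
  from tendsto_mult[OF this Suc.IH]
  have "(\<lambda>n. (real n - real k) * (l / real n) / ((1 - l / real n) * (real k + 1))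
        * Bernstein n k (l / real n)) \<longlonglongrightarrow> l ^ Suc k / fact (Suc k) * exp (- l)"
    by (simp add: algebra_simps)
  then show ?case
  proof (rule Lim_transform_eventually)
    show "eventually (\<lambda>n. (real n - real k) * (l / real n) / ((1 - l / real n) * (real k + 1))
        * Bernstein n k (l / real n) = Bernstein n (Suc k) (l / real n)) sequentially"
      using pos eventually_ge_at_top[of k]
    proof eventually_elim
      case (elim n)
      define x where "x = l / real n"
      have "(1 - x) * (real k + 1) > 0"
        using elim by (intro mult_pos_pos) (simp_all add: x_def)
      then have "(1 - x) * (real k + 1) \<noteq> 0" by (rule less_imp_neq[symmetric])
      then show ?case
        using Bernstein_Suc_ratio[OF elim(2), of x] unfolding x_def[symmetric]
        by (simp add: nonzero_divide_eq_eq nonzero_eq_divide_eq mult_ac)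
    qed
  qed
qed

lemma prob_binomial_eq_sum_Bernstein:
  assumes "finite A" "0 \<le> p" "p \<le> 1"
  shows "measure_pmf.prob (binomial_pmf n p) A = (\<Sum>k\<in>A. Bernstein n k p)"
  using assms by (simp add: measure_measure_pmf_finite Bernstein_def)

section \<open>Interval probabilities\<close>

theorem corollary5:
  fixes l :: real and m\<^sub>1 m\<^sub>2 :: nat
  assumes "l > 0"
    and "m\<^sub>1 \<ge> 1" and "m\<^sub>2 \<ge> 1"
    and "real m\<^sub>1 \<le> l" and "l \<le> real m\<^sub>2"
  shows "strict_antimono_on {m\<^sub>2 + 1..}
           (\<lambda>n::nat. measure_pmf.prob (binomial_pmf n (l / real n)) {k. m\<^sub>1 \<le> k \<and> k \<le> m\<^sub>2})
       \<and> (\<lambda>n::nat. measure_pmf.prob (binomial_pmf n (l / real n)) {k. m\<^sub>1 \<le> k \<and> k \<le> m\<^sub>2})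
           \<longlonglongrightarrow> measure_pmf.prob (poisson_pmf l) {k. m\<^sub>1 \<le> k \<and> k \<le> m\<^sub>2}
       \<and> (\<forall>n\<ge>m\<^sub>2 + 1. measure_pmf.prob (binomial_pmf n (l / real n)) {k. m\<^sub>1 \<le> k \<and> k \<le> m\<^sub>2}
             > measure_pmf.prob (poisson_pmf l) {k. m\<^sub>1 \<le> k \<and> k \<le> m\<^sub>2})"
proof -
  have set: "{k. m\<^sub>1 \<le> k \<and> k \<le> m\<^sub>2} = {m\<^sub>1..m\<^sub>2}" by auto
  define f where
    "f n = measure_pmf.prob (binomial_pmf n (l / real n)) {k. m\<^sub>1 \<le> k \<and> k \<le> m\<^sub>2}" for n
  define L where "L = measure_pmf.prob (poisson_pmf l) {k. m\<^sub>1 \<le> k \<and> k \<le> m\<^sub>2}"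
  obtain c where c: "m\<^sub>1 = Suc c" using \<open>m\<^sub>1 \<ge> 1\<close> by (cases m\<^sub>1) auto
  have "c < m\<^sub>2" using assms c by linarith
  \<comment> \<open>From \<open>l \<le> m\<^sub>2 < n\<close> the parameter \<open>l / n\<close>
    lies in the unit interval, where the Bernstein formula applies.\<close>
  have f_sum: "f n = (\<Sum>k=m\<^sub>1..m\<^sub>2. Bernstein n k (l / real n))" if "m\<^sub>2 < n" for n
    unfolding f_def set using that assms by (intro prob_binomial_eq_sum_Bernstein) auto
  have split: "{..m\<^sub>2} = {..c} \<union> {m\<^sub>1..m\<^sub>2}" "{..c} \<inter> {m\<^sub>1..m\<^sub>2} = {}"
    using c \<open>c < m\<^sub>2\<close> by auto
  have f_diff: "f n = (\<Sum>k\<le>m\<^sub>2. Bernstein n k (l / real n)) - (\<Sum>k\<le>c. Bernstein n k (l / real n))"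
    if "m\<^sub>2 < n" for n
    unfolding f_sum[OF that] split(1) by (subst sum.union_disjoint) (use split(2) in auto)
  have step: "f (Suc n) < f n" if "m\<^sub>2 < n" for n
  proof -
    \<comment> \<open>The monotonicity lemmas compare \<open>N + 1\<close> with \<open>N + 2\<close>
      trials.\<close>
    define N where "N = n - 1"
    have N: "n = Suc N" "m\<^sub>2 \<le> N" using that by (simp_all add: N_def)
    have "(\<Sum>k\<le>m\<^sub>2. Bernstein (Suc n) k (l / real (Suc n))) < (\<Sum>k\<le>m\<^sub>2. Bernstein n k (l / real n))"
      unfolding N using assms N by (intro binomial_cdf_decreasing) auto
    moreover have "(\<Sum>k\<le>c. Bernstein n k (l / real n)) \<le> (\<Sum>k\<le>c. Bernstein (Suc n) k (l / real (Suc n)))"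
      unfolding N using assms N c by (intro binomial_cdf_increasing) auto
    ultimately show ?thesis using that by (simp add: f_diff)
  qed
  have less: "f n < f m" if "m\<^sub>2 < m" "m < n" for m n
    using that(2,1)
  proof (induction m n rule: less_Suc_induct)
    case (1 i) then show ?case using step by simp
  next
    case (2 i j k)
    then show ?case by (meson order.strict_trans)
  qed
  have "(\<lambda>n. \<Sum>k=m\<^sub>1..m\<^sub>2. Bernstein n k (l / real n))
      \<longlonglongrightarrow> (\<Sum>k=m\<^sub>1..m\<^sub>2. l ^ k / fact k * exp (- l))"
    by (intro tendsto_sum Bernstein_tendsto_poisson)
  moreover have "L = (\<Sum>k=m\<^sub>1..m\<^sub>2. l ^ k / fact k * exp (- l))"
    unfolding L_def set using \<open>l > 0\<close> by (simp add: measure_measure_pmf_finite)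
  ultimately have "(\<lambda>n. \<Sum>k=m\<^sub>1..m\<^sub>2. Bernstein n k (l / real n)) \<longlonglongrightarrow> L"
    by simp
  moreover have "\<forall>\<^sub>F n in sequentially. (\<Sum>k=m\<^sub>1..m\<^sub>2. Bernstein n k (l / real n)) = f n"
    using eventually_gt_at_top[of m\<^sub>2] by eventually_elim (simp add: f_sum)
  ultimately have lim: "f \<longlonglongrightarrow> L"
    by (rule Lim_transform_eventually)
  have gt: "L < f n" if "m\<^sub>2 < n" for n
  proof -
    \<comment> \<open>Passing to the limit gives only a weak bound, so it is taken at
      \<open>Suc n\<close>; one strict step then separates \<open>f n\<close> from
      \<open>L\<close>.\<close>
    have "L \<le> f (Suc n)"
    proof (rule LIMSEQ_le_const2[OF lim], intro exI allI impI)
      fix k assume "Suc n \<le> k"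
      then show "f k \<le> f (Suc n)" using less[of "Suc n" k] that by (cases "k = Suc n") auto
    qed
    with step[OF that] show ?thesis by simp
  qed
  have "strict_antimono_on {m\<^sub>2 + 1..} f"
    by (rule monotone_onI) (use less in auto)
  with lim gt show ?thesis
    unfolding f_def L_def by auto
qed

end
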